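(* Let $0\le a<b$ and $0\le c<d$ be real numbers, let $M=[a,b)$ and $N=[c,d)$ be the corresponding interval modules, and set $$m_1=\max\{|a-c|,|b-d|\},\qquad m_2=\max\left\{\tfrac{b-a}{2},\tfrac{d-c}{2}\right\}.$$ Let $V^1,V^2,\dots$ be the progression of nonempty varieties of $\epsilon$-interleavings between $M$ and $N$, as $\epsilon>0$ increases. Then the progression is always one of the following (where "axis" means one of the two coordinate axes of $\mathbb{R}^2$, "plane" means $\mathbb{R}^2$, "origin" means $\{(0,0)\}$, and "hyperbola" means $\{(k,\ell)\in\mathbb{R}^2 : k\ell=1\}$): (origin, axis, origin); (axis, origin); (hyperbola, plane, axis, origin); (hyperbola, plane, origin). Moreover: (i) $m_1>m_2$ $\iff$ $V^1$ is the origin $\iff$ the full progression is origin, axis, origin. (ii) $m_1=m_2$ $\iff$ $V^1$ is an axis $\iff$ the full progression is axis, origin. (iii) $m_1<m_2$ $\iff$ $V^1$ is a hyperbola $\iff$ the full progression is hyperbola, plane, axis, origin or hyperbola, plane, origin.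
   Context: A persistence module $M$ assigns to each $x\in[0,\infty)$ a real vector space $M(x)$ and to each $x\le y$ a linear map $M(x\le y):M(x)\to M(y)$ with $M(x\le z)=M(y\le z)\circ M(x\le y)$ for $x\le y\le z$. A morphism $F:M\to N$ is a family of linear maps $F(x):M(x)\to N(x)$, $x\in[0,\infty)$, with $F(y)\circ M(x\le y)=N(x\le y)\circ F(x)$ for $x\le y$; $H(M,N)$ denotes the vector space of morphisms $M\to N$. For $\epsilon\ge 0$ the shift $M\epsilon$ is the persistence module $(M\epsilon)(x)=M(x+\epsilon)$, with the corresponding structure maps. For $0\le\alpha<\beta$, the interval module $[\alpha,\beta)$ is the persistence module equal to $\mathbb{R}$ at $x\in[\alpha,\beta)$ and $0$ elsewhere, with structure maps the identity when $x,y\in[\alpha,\beta)$ and $0$ otherwise. For interval modules $M,N$, $H(M,N)$ is either zero or one-dimensional (a nonzero morphism being given by a single real parameter). For persistence modules $M,N$ set $$S_{M,N}=\{x\ge 0 : H(M,Nx)\ne\{0\}\}.$$ Variety of interleavings (for interval modules). An $\epsilon$-interleaving between $M$ and $N$ is a pair of morphisms $\Phi:M\to N\epsilon$, $\Psi:N\to M\epsilon$ such that $(\Psi\epsilon)\circ\Phi=\Pi_M^{M2\epsilon}$ and $(\Phi\epsilon)\circ\Psi=\Pi_N^{N2\epsilon}$, where $(\Phi\epsilon)(x)=\Phi(x+\epsilon)$ (similarly $\Psi\epsilon$), and $\Pi_P^{P\tau}:P\to P\tau$ is given by $\Pi_P^{P\tau}(x)=P(x\le x+\tau)$. When $M$ and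 $N$ are interval modules, $\Phi$ and $\Psi$ are encoded by real parameters $k$ and $\ell$ respectively. For $\epsilon>0$, the variety of $\epsilon$-interleavings $V_{M,N}^\epsilon\subseteq\mathbb{R}^2$ (coordinates $(k,\ell)$) is the zero set of the following polynomials: $k$, if $\epsilon\notin S_{M,N}$; $\ell$, if $\epsilon\notin S_{N,M}$; $k\ell-1$, if $2\epsilon\in S_{M,M}$ or $2\epsilon\in S_{N,N}$. (For $M=[a,b)$, $2\epsilon\in S_{M,M}$ iff $\epsilon<\frac{b-a}{2}$, and similarly for $N$.) If none of these conditions applies, $V_{M,N}^\epsilon=\mathbb{R}^2$. Progression. As $\epsilon>0$ increases, $V_{M,N}^\epsilon$ takes only finitely many values. The progression is the ordered list $V^1,V^2,\dots$ of nonempty varieties which successively occur as $\epsilon$ increases through $(0,\infty)$, a new entry being recorded each time the variety changes (so consecutive entries are distinct, but a variety may reappear later in the list). $V^i$ is the $i$-th entry. *)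

theory Defs
  imports Complex_Main
begin

text \<open>
  A persistence module is given by subspaces \<open>pm_space M x\<close> of one real vector space
  \<open>'v\<close> and by maps \<open>pm_map M x y\<close> between them.  Only indices \<open>x \<ge> 0\<close>
  and vectors in the carriers are meaningful.
\<close>

record 'v pmodule =
  pm_space :: "real \<Rightarrow> 'v set"
  pm_map :: "real \<Rightarrow> real \<Rightarrow> 'v \<Rightarrow> 'v"

definition linear_between ::
    "'v::real_vector set \<Rightarrow> 'w::real_vector set \<Rightarrow> ('v \<Rightarrow> 'w) \<Rightarrow> bool" where
  "linear_between U W f \<longleftrightarrow>
     f ` U \<subseteq> W \<and>
     (\<forall>u\<in>U. \<forall>v\<in>U. f (u + v) = f u + f v) \<and>
     (\<forall>r. \<forall>u\<in>U. f (r *\<^sub>R u) = r *\<^sub>R f u)"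

definition persistence_module :: "'v::real_vector pmodule \<Rightarrow> bool" where
  "persistence_module M \<longleftrightarrow>
     (\<forall>x\<ge>0. subspace (pm_space M x)) \<and>
     (\<forall>x y. 0 \<le> x \<longrightarrow> x \<le> y \<longrightarrow> linear_between (pm_space M x) (pm_space M y) (pm_map M x y)) \<and>
     (\<forall>x y z. 0 \<le> x \<longrightarrow> x \<le> y \<longrightarrow> y \<le> z \<longrightarrow>
        (\<forall>v\<in>pm_space M x. pm_map M x z v = pm_map M y z (pm_map M x y v)))"

text \<open>
  Morphisms are represented by functions that vanish at irrelevant arguments (negative indices,
  vectors outside the carrier), so that equality of morphisms is equality of functions.
\<close>

definition zero_morphism :: "real \<Rightarrow> 'v::real_vector \<Rightarrow> 'w::real_vector" where
  "zero_morphism = (\<lambda>x v. 0)"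

definition pm_hom ::
    "'v::real_vector pmodule \<Rightarrow> 'w::real_vector pmodule \<Rightarrow> (real \<Rightarrow> 'v \<Rightarrow> 'w) set" where
  "pm_hom M N = {F.
     (\<forall>x\<ge>0. linear_between (pm_space M x) (pm_space N x) (F x)) \<and>
     (\<forall>x y. 0 \<le> x \<longrightarrow> x \<le> y \<longrightarrow>
        (\<forall>v\<in>pm_space M x. F y (pm_map M x y v) = pm_map N x y (F x v))) \<and>
     (\<forall>x v. \<not> (0 \<le> x \<and> v \<in> pm_space M x) \<longrightarrow> F x v = 0)}"

definition pm_shift :: "'v pmodule \<Rightarrow> real \<Rightarrow> 'v pmodule" where
  "pm_shift M e =
     \<lparr>pm_space = (\<lambda>x. pm_space M (x + e)), pm_map = (\<lambda>x y. pm_map M (x + e) (y + e))\<rparr>"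

definition interval_module :: "real \<Rightarrow> real \<Rightarrow> real pmodule" where
  "interval_module \<alpha> \<beta> =
     \<lparr>pm_space = (\<lambda>x. if x \<in> {\<alpha>..<\<beta>} then UNIV else {0}),
      pm_map = (\<lambda>x y v. if x \<in> {\<alpha>..<\<beta>} \<and> y \<in> {\<alpha>..<\<beta>} then v else 0)\<rparr>"

lemma persistence_module_interval: "persistence_module (interval_module \<alpha> \<beta>)"
  by (auto simp: persistence_module_def interval_module_def linear_between_def subspace_def)

lemma persistence_module_shift:
  assumes "persistence_module M" "0 \<le> e"
  shows "persistence_module (pm_shift M e)"
  using assms by (simp add: persistence_module_def pm_shift_def)

definition shift_set :: "'v::real_vector pmodule \<Rightarrow> 'w::real_vector pmodule \<Rightarrow> real set" where
  "shift_set M N = {x. 0 \<le> x \<and> pm_hom M (pm_shift N x) \<noteq> {zero_morphism}}"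

text \<open>The zero set of those among the polynomials \<open>k\<close>, \<open>l\<close>, \<open>k l - 1\<close>
  whose condition applies.\<close>

definition interleaving_variety ::
    "'v::real_vector pmodule \<Rightarrow> 'w::real_vector pmodule \<Rightarrow> real \<Rightarrow> (real \<times> real) set" where
  "interleaving_variety M N \<epsilon> = {(k, l).
     (\<epsilon> \<notin> shift_set M N \<longrightarrow> k = 0) \<and>
     (\<epsilon> \<notin> shift_set N M \<longrightarrow> l = 0) \<and>
     (2 * \<epsilon> \<in> shift_set M M \<or> 2 * \<epsilon> \<in> shift_set N N \<longrightarrow> k * l - 1 = 0)}"

text \<open>
  The list \<open>vs\<close> is the progression of a family \<open>V\<close> if the parameters with
  \<open>V \<epsilon>\<close> nonempty are numbered monotonically by the positions of \<open>vs\<close>, every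
  position being used, and consecutive entries of \<open>vs\<close> differ.  Values may reappear later.
\<close>

definition is_progression :: "(real \<Rightarrow> 'p set) \<Rightarrow> 'p set list \<Rightarrow> bool" where
  "is_progression V vs \<longleftrightarrow>
     (let E = {\<epsilon>. 0 < \<epsilon> \<and> V \<epsilon> \<noteq> {}} in
      \<exists>i :: real \<Rightarrow> nat. mono_on E i \<and> i ` E = {..<length vs} \<and>
        (\<forall>\<epsilon>\<in>E. V \<epsilon> = vs ! i \<epsilon>) \<and> distinct_adj vs)"

definition progression :: "(real \<Rightarrow> 'p set) \<Rightarrow> 'p set list" where
  "progression V = (THE vs. is_progression V vs)"

definition origin :: "(real \<times> real) set" where
  "origin = {(0, 0)}"

definition is_axis :: "(real \<times> real) set \<Rightarrow> bool" where
  "is_axis A \<longleftrightarrow> A = {(k, l). l = 0} \<or> A = {(k, l). k = 0}"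

definition plane :: "(real \<times> real) set" where
  "plane = UNIV"

definition hyperbola :: "(real \<times> real) set" where
  "hyperbola = {(k, l). k * l = 1}"

end

theory Submission
  imports Defs
begin

text \<open>
  A nonzero morphism \<open>[a, b) \<rightarrow> [c, d)\<epsilon>\<close> exists iff
  \<open>c - \<epsilon> \<le> a < d - \<epsilon> \<le> b\<close>, so each of \<open>\<epsilon> \<in> S\<^sub>M\<^sub>N\<close> and \<open>\<epsilon> \<in> S\<^sub>N\<^sub>M\<close> says that
  \<open>\<epsilon>\<close> lies in a half-open interval.  The larger left end of the two intervals is \<open>m\<^sub>1\<close>,
  and the relation \<open>k l = 1\<close> is imposed exactly for \<open>\<epsilon> < m\<^sub>2\<close>.  If \<open>m\<^sub>1 < m\<^sub>2\<close>, both
  right ends exceed \<open>m\<^sub>2\<close>; if \<open>m\<^sub>1 \<ge> m\<^sub>2\<close>, the interval that does not start at \<open>m\<^sub>1\<close> ends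
  no later than \<open>m\<^sub>2\<close>.  Both facts are linear arithmetic and give the progressions.
\<close>

section \<open>Progressions\<close>

text \<open>By distinctness of neighbours, the value of \<open>V\<close> changes whenever
  \<open>i\<close> rises by one, and \<open>j\<close> can follow such a change only by rising too.
  As \<open>i\<close> skips no position, \<open>j\<close> has risen at least as often as
  \<open>i\<close>. Applied in both directions, this identifies two numberings.\<close>

lemma progression_index_le:
  fixes E :: "real set" and i j :: "real \<Rightarrow> nat"
  assumes i: "mono_on E i" "i ` E = {..<length vs}" "\<And>x. x \<in> E \<Longrightarrow> V x = vs ! i x"
      "distinct_adj vs"
    and j: "mono_on E j" "\<And>x. x \<in> E \<Longrightarrow> V x = ws ! j x"
  shows "x \<in> E \<Longrightarrow> i x \<le> j x"
proof (induction "j x" arbitrary: x rule: less_induct)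
  case less
  show ?case
  proof (rule ccontr)
    assume "\<not> i x \<le> j x"
    then obtain n where n: "i x = Suc n" "j x \<le> n"
      by (cases "i x") auto
    have len: "Suc n < length vs"
      using imageI[OF less.prems, of i] unfolding i(2) n by simp
    then have "n \<in> i ` E"
      using i(2) by simp
    then obtain y where y: "y \<in> E" "i y = n"
      by blast
    have "y \<le> x"
      using mono_onD[OF i(1) less.prems y(1)] n y by (cases "y \<le> x") auto
    then have "j y \<le> j x"
      using mono_onD[OF j(1) y(1) less.prems] by simp
    \<comment> \<open>Otherwise the induction hypothesis at \<open>y\<close> would give
      \<open>n \<le> j y < j x\<close>, against \<open>j x \<le> n\<close>.\<close>
    moreover have "\<not> j y < j x"
      using less.hyps[OF _ y(1)] y n by linarith
    ultimately have "V y = V x"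
      using j(2) y(1) less.prems by simp
    then have "vs ! n = vs ! Suc n"
      using i(3) y less.prems n by simp
    then show False
      using i(4) len by (simp add: distinct_adj_conv_nth)
  qed
qed

text \<open>The two numberings agree on \<open>E\<close> and are onto the positions of their lists,
  so lengths and entries agree. This gives the definite description in \<open>progression\<close>
  its meaning.\<close>

lemma is_progression_unique:
  assumes "is_progression V vs" "is_progression V ws"
  shows "vs = ws"
proof -
  define E where "E = {\<epsilon>. 0 < \<epsilon> \<and> V \<epsilon> \<noteq> {}}"
  obtain i where i: "mono_on E i" "i ` E = {..<length vs}" "\<And>x. x \<in> E \<Longrightarrow> V x = vs ! i x"
      "distinct_adj vs"
    using assms(1) unfolding is_progression_def Let_def E_def by blast
  obtain j where j: "mono_on E j" "j ` E = {..<length ws}" "\<And>x. x \<in> E \<Longrightarrow> V x = ws ! j x"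
      "distinct_adj ws"
    using assms(2) unfolding is_progression_def Let_def E_def by blast
  have ij: "i x = j x" if "x \<in> E" for x
    using progression_index_le[OF i j(1,3) that] progression_index_le[OF j i(1,3) that] by simp
  then have "i ` E = j ` E"
    by simp
  then have "length vs = length ws"
    using i(2) j(2) by simp
  moreover have "vs ! n = ws ! n" if "n < length vs" for n
  proof -
    have "n \<in> i ` E"
      using that i(2) by simp
    then obtain x where "x \<in> E" "i x = n"
      by blast
    then show ?thesis
      using i(3)[of x] j(3)[of x] ij[of x] by simp
  qed
  ultimately show ?thesis
    by (rule nth_equalityI)
qed

lemma progression_eq:
  assumes "is_progression V vs"
  shows "progression V = vs"
  unfolding progression_def using assms is_progression_unique by blast

lemma is_progression_single:
  assumes "A \<noteq> {}" "0 < e" "V e = A" "\<And>x. 0 < x \<Longrightarrow> V x = {} \<or> V x = A"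
  shows "is_progression V [A]"
  unfolding is_progression_def Let_def
proof (intro exI[of _ "\<lambda>_. 0"] conjI)
  show "(\<lambda>_. 0) ` {\<epsilon>. 0 < \<epsilon> \<and> V \<epsilon> \<noteq> {}} = {..<length [A]}"
    using assms by auto
qed (use assms in \<open>auto simp: mono_on_def\<close>)

text \<open>Progressions are built from the back: \<open>W\<close> is \<open>V\<close> with all
  parameters below \<open>t\<close> blanked out, so \<open>vs\<close> records what happens from
  \<open>t\<close> on, and \<open>e\<close> witnesses that the new first entry \<open>A\<close>
  really occurs before \<open>t\<close>.\<close>

lemma is_progression_Cons:
  assumes W: "is_progression W vs" "\<And>x. 0 < x \<Longrightarrow> x < t \<Longrightarrow> W x = {}"
    and vs: "vs \<noteq> []" "hd vs \<noteq> A"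
    and A: "A \<noteq> {}" "0 < e" "e < t" "V e = A"
      "\<And>x. 0 < x \<Longrightarrow> x < t \<Longrightarrow> V x = {} \<or> V x = A"
    and VW: "\<And>x. t \<le> x \<Longrightarrow> V x = W x"
  shows "is_progression V (A # vs)"
proof -
  define E where "E = {\<epsilon>. 0 < \<epsilon> \<and> W \<epsilon> \<noteq> {}}"
  define E' where "E' = {\<epsilon>. 0 < \<epsilon> \<and> V \<epsilon> \<noteq> {}}"
  obtain i where i: "mono_on E i" "i ` E = {..<length vs}" "\<And>x. x \<in> E \<Longrightarrow> W x = vs ! i x"
      "distinct_adj vs"
    using W(1) unfolding is_progression_def Let_def E_def by blast
  define j where "j x = (if x < t then 0 else Suc (i x))" for x
  have E: "x \<in> E \<longleftrightarrow> x \<in> E' \<and> t \<le> x" for x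
    using W(2)[of x] VW[of x] by (cases "x < t") (auto simp: E_def E'_def)
  have e: "e \<in> E'" "j e = 0"
    using A by (auto simp: E'_def j_def)
  have "mono_on E' j"
    using i(1) by (auto simp: mono_on_def j_def E)
  moreover have "j ` E' = {..<length (A # vs)}"
  proof -
    have "j ` E = Suc ` i ` E"
      unfolding image_image by (rule image_cong) (auto simp: j_def E)
    moreover have "j ` E' = insert 0 (j ` E)"
      using e by (auto simp: j_def E image_iff)
    ultimately show ?thesis
      using i(2) by (simp add: lessThan_Suc_eq_insert_0)
  qed
  moreover have "V x = (A # vs) ! j x" if "x \<in> E'" for x
  proof (cases "x < t")
    case True
    then show ?thesis
      using that A(5)[of x] by (auto simp: E'_def j_def)
  next
    case False
    then show ?thesis
      using that i(3)[of x] VW[of x] by (simp add: E j_def)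
  qed
  moreover have "distinct_adj (A # vs)"
    using i(4) vs by (cases vs) auto
  ultimately show ?thesis
    unfolding is_progression_def Let_def E'_def by blast
qed

lemma is_progression_two:
  assumes "A \<noteq> {}" "B \<noteq> {}" "A \<noteq> B" "0 < s" "s < t"
    and V: "\<And>x. 0 < x \<Longrightarrow> V x = (if x < s then {} else if x < t then A else B)"
  shows "is_progression V [A, B]"
\<comment> \<open>The stretches are closed on the left, so \<open>s\<close> itself already takes the
  value \<open>A\<close>.\<close>
proof (rule is_progression_Cons[where W = "\<lambda>x. if x < t then {} else B" and t = t and e = s])
  show "is_progression (\<lambda>x. if x < t then {} else B) [B]"
    by (rule is_progression_single[where e = t]) (use assms(2,4,5) in auto)
  show "V s = A"
    using V[of s] assms(4,5) by simp
  show "V x = {} \<or> V x = A" if "0 < x" "x < t" for x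
    using V[of x] that by simp
  show "V x = (if x < t then {} else B)" if "t \<le> x" for x
    using V[of x] assms(4,5) that by simp
qed (use assms(1-5) in auto)

lemma is_progression_three:
  assumes "A \<noteq> {}" "B \<noteq> {}" "C \<noteq> {}" "A \<noteq> B" "B \<noteq> C" "0 < r" "r < s" "s < t"
    and V: "\<And>x. 0 < x \<Longrightarrow>
      V x = (if x < r then {} else if x < s then A else if x < t then B else C)"
  shows "is_progression V [A, B, C]"
proof (rule is_progression_Cons[where t = s and e = r
      and W = "\<lambda>x. if x < s then {} else if x < t then B else C"])
  show "is_progression (\<lambda>x. if x < s then {} else if x < t then B else C) [B, C]"
    by (rule is_progression_two[where s = s and t = t]) (use assms(1-8) in auto)
  show "V r = A"
    using V[of r] assms(6-8) by simp
  show "V x = {} \<or> V x = A" if "0 < x" "x < s" for x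
    using V[of x] that by simp
  show "V x = (if x < s then {} else if x < t then B else C)" if "s \<le> x" for x
    using V[of x] assms(6-8) that by simp
qed (use assms(1-8) in auto)

section \<open>Varieties of interleavings of interval modules\<close>

text \<open>The shifted target is supported on \<open>{c - e..<d - e}\<close>. Off the common
  support a component vanishes because its source or target is zero; on it, one of the outer
  inequalities must fail, and naturality then kills the component.\<close>

lemma pm_hom_interval_shift_trivial:
  assumes "0 \<le> a" "\<not> (c - e \<le> a \<and> a < d - e \<and> d - e \<le> b)"
    and F: "F \<in> pm_hom (interval_module a b) (pm_shift (interval_module c d) e)"
  shows "F = zero_morphism"
proof -
  let ?M = "interval_module a b" and ?N = "pm_shift (interval_module c d) e"
  have lin: "\<And>x. 0 \<le> x \<Longrightarrow> linear_between (pm_space ?M x) (pm_space ?N x) (F x)"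
    and comm: "\<And>x y v. 0 \<le> x \<Longrightarrow> x \<le> y \<Longrightarrow> v \<in> pm_space ?M x \<Longrightarrow>
        F y (pm_map ?M x y v) = pm_map ?N x y (F x v)"
    and out: "\<And>x v. \<not> (0 \<le> x \<and> v \<in> pm_space ?M x) \<Longrightarrow> F x v = 0"
    using F unfolding pm_hom_def by auto
  have F0: "F x 0 = 0" if "0 \<le> x" for x
  proof -
    have "0 \<in> pm_space ?M x"
      by (simp add: interval_module_def)
    then show ?thesis
      using lin[OF that] unfolding linear_between_def by (metis scaleR_zero_left)
  qed
  have "F x v = 0" for x v
  proof (cases "a \<le> x \<and> x < b \<and> c - e \<le> x \<and> x < d - e")
    case False
    consider "\<not> (0 \<le> x \<and> v \<in> pm_space ?M x)" | "0 \<le> x" "\<not> (a \<le> x \<and> x < b)" "v \<in> pm_space ?M x"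
      | "0 \<le> x" "\<not> (c - e \<le> x \<and> x < d - e)" "v \<in> pm_space ?M x"
      using False by blast
    then show ?thesis
    proof cases
      case 1
      then show ?thesis by (rule out)
    next
      case 2
      then show ?thesis using F0 by (auto simp: interval_module_def)
    next
      case 3
      have "F x v \<in> pm_space ?N x"
        using lin[OF 3(1)] 3(3) by (auto simp: linear_between_def)
      then show ?thesis
        using 3(2) by (auto simp: interval_module_def pm_shift_def split: if_splits)
    qed
  next
    case True
    with assms(2) consider "a < c - e" | "b < d - e"
      by linarith
    then show ?thesis
    proof cases
      \<comment> \<open>The vector \<open>v\<close> at \<open>x\<close> comes from \<open>v\<close>
        at \<open>a\<close>, where the target is still zero.\<close>
      case 1
      then show ?thesis
        using comm[of a x v] True assms(1) by (simp add: interval_module_def pm_shift_def)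
    next
      \<comment> \<open>The source has died at \<open>b\<close>, while the target map from
        \<open>x\<close> to \<open>b\<close> is still the identity.\<close>
      case 2
      then show ?thesis
        using comm[of x b v] True assms(1) F0[of b]
        by (simp add: interval_module_def pm_shift_def)
    qed
  qed
  then show ?thesis
    by (simp add: zero_morphism_def fun_eq_iff)
qed

lemma pm_hom_interval_shift_nontrivial:
  assumes "0 \<le> a" "c - e \<le> a" "a < d - e" "d - e \<le> b"
  shows "pm_hom (interval_module a b) (pm_shift (interval_module c d) e) \<noteq> {zero_morphism}"
proof -
  \<comment> \<open>Under the assumed inequalities the two supports meet exactly in
    \<open>{a..<d - e}\<close>; \<open>F\<close> is the identity there.\<close>
  define F :: "real \<Rightarrow> real \<Rightarrow> real" where "F x v = (if a \<le> x \<and> x < d - e then v else 0)" for x v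
  have "F \<in> pm_hom (interval_module a b) (pm_shift (interval_module c d) e)"
    using assms
    by (auto simp: pm_hom_def F_def interval_module_def pm_shift_def linear_between_def)
  moreover have "F a 1 \<noteq> 0"
    using assms by (simp add: F_def)
  then have "F \<noteq> zero_morphism"
    by (auto simp: zero_morphism_def)
  ultimately show ?thesis
    by blast
qed

text \<open>Rules out an empty set of morphisms, which would also differ from
  \<open>{zero_morphism}\<close> in \<open>shift_set\<close>.\<close>

lemma zero_morphism_in_pm_hom_interval_shift:
  "zero_morphism \<in> pm_hom (interval_module a b) (pm_shift (interval_module c d) e)"
  by (auto simp: pm_hom_def zero_morphism_def interval_module_def pm_shift_def linear_between_def)

lemma shift_set_interval:
  assumes "0 \<le> a"
  shows "e \<in> shift_set (interval_module a b) (interval_module c d) \<longleftrightarrow>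
    0 \<le> e \<and> c - e \<le> a \<and> a < d - e \<and> d - e \<le> b"
  using pm_hom_interval_shift_trivial[OF assms, of c e d b]
    pm_hom_interval_shift_nontrivial[OF assms, of c e d b]
    zero_morphism_in_pm_hom_interval_shift[of a b c d e]
  unfolding shift_set_def by blast

text \<open>Here \<open>x\<close> and \<open>y\<close> say that \<open>k\<close> and
  \<open>l\<close>, respectively, are not forced to be zero. Below the larger half-length
  \<open>k * l = 1\<close> is imposed, which is contradictory as soon as one coordinate is forced to
  vanish.\<close>

lemma interleaving_variety_interval:
  fixes a b c d \<epsilon> :: real
  assumes "0 \<le> a" "a < b" "0 \<le> c" "c < d" "0 < \<epsilon>"
  shows "interleaving_variety (interval_module a b) (interval_module c d) \<epsilon> =
    (let x = (max (c - a) (d - b) \<le> \<epsilon> \<and> \<epsilon> < d - a);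
         y = (max (a - c) (b - d) \<le> \<epsilon> \<and> \<epsilon> < b - c)
     in if \<epsilon> < max ((b - a) / 2) ((d - c) / 2) then (if x \<and> y then hyperbola else {})
        else if x \<and> y then plane else if x then {(k, l). l = 0}
        else if y then {(k, l). k = 0} else origin)"
proof -
  have x: "\<epsilon> \<in> shift_set (interval_module a b) (interval_module c d) \<longleftrightarrow>
      max (c - a) (d - b) \<le> \<epsilon> \<and> \<epsilon> < d - a"
    and y: "\<epsilon> \<in> shift_set (interval_module c d) (interval_module a b) \<longleftrightarrow>
      max (a - c) (b - d) \<le> \<epsilon> \<and> \<epsilon> < b - c"
    using assms by (auto simp: shift_set_interval)
  have z: "2 * \<epsilon> \<in> shift_set (interval_module a b) (interval_module a b) \<or>
      2 * \<epsilon> \<in> shift_set (interval_module c d) (interval_module c d) \<longleftrightarrow>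
      \<epsilon> < max ((b - a) / 2) ((d - c) / 2)"
    using assms by (auto simp: shift_set_interval less_max_iff_disj)
  show ?thesis
    unfolding interleaving_variety_def x y z Let_def
    by (auto simp: hyperbola_def plane_def origin_def)
qed

lemma variety_distinct:
  "hyperbola \<noteq> plane" "hyperbola \<noteq> origin" "plane \<noteq> origin"
  "hyperbola \<noteq> {}" "plane \<noteq> {}" "origin \<noteq> {}"
proof -
  have "(1, 1) \<in> hyperbola" "(0, 0) \<notin> hyperbola" "(0, 0) \<in> plane" "(1, 1) \<in> plane"
      "(0, 0) \<in> origin" "(1, 1) \<notin> origin"
    by (auto simp: hyperbola_def plane_def origin_def)
  then show "hyperbola \<noteq> plane" "hyperbola \<noteq> origin" "plane \<noteq> origin"
      "hyperbola \<noteq> {}" "plane \<noteq> {}" "origin \<noteq> {}"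
    by blast+
qed

lemma is_axis_distinct:
  assumes "is_axis A"
  shows "A \<noteq> hyperbola" "A \<noteq> plane" "A \<noteq> origin" "A \<noteq> {}"
proof -
  have "(1, 1) \<notin> A" "(0, 0) \<in> A" "(1, 0) \<in> A \<or> (0, 1) \<in> A"
    using assms by (auto simp: is_axis_def)
  moreover have "(1, 1) \<in> hyperbola" "(1, 1) \<in> plane" "(1, 0) \<notin> origin" "(0, 1) \<notin> origin"
    by (auto simp: hyperbola_def plane_def origin_def)
  ultimately show "A \<noteq> hyperbola" "A \<noteq> plane" "A \<noteq> origin" "A \<noteq> {}"
    by blast+
qed

lemma is_axis_axes: "is_axis {(k, l). l = 0}" "is_axis {(k, l). k = 0}"
  by (auto simp: is_axis_def)

section \<open>The three types of progressions\<close>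

lemma is_progression_hyperbola_Cons:
  assumes "is_progression (\<lambda>x. if x < t then {} else V x) (plane # vs)" "0 \<le> r" "r < t"
    and V: "\<And>x. 0 < x \<Longrightarrow> x < t \<Longrightarrow> V x = (if x < r then {} else hyperbola)"
  shows "is_progression V (hyperbola # plane # vs)"
\<comment> \<open>The left end \<open>r\<close> may be 0, which is not an admissible parameter; the
  midpoint is positive and lies in the hyperbola stretch.\<close>
proof (rule is_progression_Cons[OF assms(1), where e = "(r + t) / 2"])
  show "V ((r + t) / 2) = hyperbola"
    using V[of "(r + t) / 2"] assms(2,3) by simp
  show "V x = {} \<or> V x = hyperbola" if "0 < x" "x < t" for x
    using V[OF that] by simp
qed (use assms(2,3) variety_distinct in auto)

context
  fixes a b c d m1 m2 :: real and V :: "real \<Rightarrow> (real \<times> real) set"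
  assumes ab: "0 \<le> a" "a < b" and cd: "0 \<le> c" "c < d"
  defines "m1 \<equiv> max \<bar>a - c\<bar> \<bar>b - d\<bar>"
    and "m2 \<equiv> max ((b - a) / 2) ((d - c) / 2)"
    and "V \<equiv> interleaving_variety (interval_module a b) (interval_module c d)"
begin

lemmas variety_value =
  interleaving_variety_interval[OF ab cd, folded V_def m2_def, unfolded Let_def]

lemma m2_pos: "0 < m2"
  using ab by (simp add: m2_def less_max_iff_disj)

text \<open>Each of \<open>d - a\<close> and \<open>b - c\<close> arises from either length
  \<open>b - a\<close> or \<open>d - c\<close> by moving one end point, a change of at most
  \<open>m1\<close>. The larger length is \<open>2 * m2\<close>, so both are at least
  \<open>2 * m2 - m1 > m2\<close>.\<close>

lemma right_ends_less:
  assumes "m1 < m2"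
  shows "m2 < d - a" "m2 < b - c"
  using assms ab cd unfolding m1_def m2_def max_def abs_if
  by (simp_all split: if_splits)

text \<open>One of the two left ends equals \<open>m1\<close>. If it is \<open>c - a\<close> or
  \<open>d - b\<close>, subtracting it from \<open>b - a\<close> or \<open>d - c\<close>,
  respectively, gives \<open>b - c \<le> 2 * m2 - m1 \<le> m2\<close>, and \<open>m1 < d - a\<close>
  since both modules have positive length. The other case is symmetric.\<close>

lemma left_end_cases:
  assumes "m2 \<le> m1"
  obtains "max (c - a) (d - b) = m1" "b - c \<le> m2" "m1 < d - a"
    | "max (a - c) (b - d) = m1" "d - a \<le> m2" "m1 < b - c"
proof -
  have "(max (c - a) (d - b) = m1 \<and> b - c \<le> m2 \<and> m1 < d - a) \<or>
      (max (a - c) (b - d) = m1 \<and> d - a \<le> m2 \<and> m1 < b - c)"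
    using assms ab cd unfolding m1_def m2_def max_def abs_if
    by (simp split: if_splits; linarith)
  then show thesis
    using that by blast
qed

text \<open>Below \<open>m2\<close> the interval starting at \<open>m1\<close> has not been entered,
  so the hyperbola relation has no solution. From \<open>m2\<close> on the other interval is over,
  so only one coordinate can be free, namely between \<open>m1\<close> and the right end
  \<open>t\<close>. For \<open>m1 = m2\<close> the first origin stretch is empty, so both remaining
  types are covered.\<close>

lemma left_end_value:
  assumes "m2 \<le> m1"
  obtains A t where "is_axis A" "m1 < t"
    "\<And>x. 0 < x \<Longrightarrow> V x = (if x < m2 then {} else if x < m1 then origin
       else if x < t then A else origin)"
  using assms
proof (cases rule: left_end_cases)
  case 1
  show thesis
    by (rule that[OF is_axis_axes(1) 1(3)]) (use 1 assms in \<open>auto simp: variety_value\<close>)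
next
  case 2
  show thesis
    by (rule that[OF is_axis_axes(2) 2(3)]) (use 2 assms in \<open>auto simp: variety_value\<close>)
qed

lemma progression_greater:
  assumes "m2 < m1"
  shows "\<exists>A. is_axis A \<and> is_progression V [origin, A, origin]"
proof -
  obtain A t where A: "is_axis A" "m1 < t"
    "\<And>x. 0 < x \<Longrightarrow> V x = (if x < m2 then {} else if x < m1 then origin
       else if x < t then A else origin)"
    using left_end_value[OF less_imp_le[OF assms]] by blast
  have "is_progression V [origin, A, origin]"
    by (rule is_progression_three[OF _ _ _ _ _ m2_pos assms A(2,3)])
      (use is_axis_distinct[OF A(1)] variety_distinct in auto)
  then show ?thesis
    using A(1) by blast
qed

lemma progression_equal:
  assumes "m1 = m2"
  shows "\<exists>A. is_axis A \<and> is_progression V [A, origin]"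
proof -
  obtain A t where A: "is_axis A" "m1 < t"
    "\<And>x. 0 < x \<Longrightarrow> V x = (if x < m2 then {} else if x < m1 then origin
       else if x < t then A else origin)"
    using left_end_value[OF eq_refl[OF assms[symmetric]]] by blast
  have "is_progression V [A, origin]"
  proof (rule is_progression_two[OF _ _ _ m2_pos, of _ _ t])
    show "V x = (if x < m2 then {} else if x < t then A else origin)" if "0 < x" for x
      using A(3)[OF that] assms by simp
  qed (use A(2) assms is_axis_distinct[OF A(1)] variety_distinct in auto)
  then show ?thesis
    using A(1) by blast
qed

text \<open>By \<open>right_ends_less\<close> both right ends lie beyond \<open>m2\<close>: the
  hyperbola persists from \<open>m1\<close> up to \<open>m2\<close>, and the plane follows until the
  smaller right end. An axis appears exactly when the right ends differ, its free coordinate being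
  the one with the larger right end.\<close>

lemma progression_less:
  assumes "m1 < m2"
  shows "(\<exists>A. is_axis A \<and> is_progression V [hyperbola, plane, A, origin]) \<or>
    is_progression V [hyperbola, plane, origin]"
proof -
  note r = right_ends_less[OF assms]
  \<comment> \<open>The two left ends together involve both signs of \<open>a - c\<close> and
    \<open>b - d\<close>, hence their absolute values.\<close>
  have left: "max (c - a) (d - b) \<le> x \<and> max (a - c) (b - d) \<le> x \<longleftrightarrow> m1 \<le> x" for x
    by (auto simp: m1_def)
  have low: "V x = (if x < m1 then {} else hyperbola)" if "0 < x" "x < m2" for x
    using that r left[of x] by (auto simp: variety_value)
  have high: "V x = (if x < d - a \<and> x < b - c then plane
      else if x < d - a then {(k, l). l = 0} else if x < b - c then {(k, l). k = 0} else origin)"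
    if "m2 \<le> x" for x
    using that assms m2_pos left[of x] by (simp add: variety_value)
  have hyp: "is_progression V (hyperbola # plane # vs)"
    if "is_progression (\<lambda>x. if x < m2 then {} else V x) (plane # vs)" for vs
    by (rule is_progression_hyperbola_Cons[OF that _ assms low]) (auto simp: m1_def)
  consider "d - a = b - c" | "d - a < b - c" | "b - c < d - a"
    by linarith
  then show ?thesis
  proof cases
    case 1
    have "is_progression (\<lambda>x. if x < m2 then {} else V x) [plane, origin]"
      by (rule is_progression_two[OF _ _ _ m2_pos r(1)]) (use 1 variety_distinct high in auto)
    then show ?thesis
      using hyp by blast
  next
    case 2
    let ?A = "{(k, l). k = 0} :: (real \<times> real) set"
    have "is_progression (\<lambda>x. if x < m2 then {} else V x) [plane, ?A, origin]"
    proof (rule is_progression_three[OF _ _ _ _ _ m2_pos r(1) 2])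
      show "(if x < m2 then {} else V x) =
          (if x < m2 then {} else if x < d - a then plane else if x < b - c then ?A else origin)" for x
        using 2 high[of x] by simp
    qed (use is_axis_distinct[OF is_axis_axes(2)] variety_distinct in metis)+
    then show ?thesis
      using hyp is_axis_axes(2) by blast
  next
    case 3
    let ?A = "{(k, l). l = 0} :: (real \<times> real) set"
    have "is_progression (\<lambda>x. if x < m2 then {} else V x) [plane, ?A, origin]"
    proof (rule is_progression_three[OF _ _ _ _ _ m2_pos r(2) 3])
      show "(if x < m2 then {} else V x) =
          (if x < m2 then {} else if x < b - c then plane else if x < d - a then ?A else origin)" for x
        using 3 high[of x] by simp
    qed (use is_axis_distinct[OF is_axis_axes(1)] variety_distinct in metis)+
    then show ?thesis
      using hyp is_axis_axes(1) by blast
  qed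
qed

end

theorem theorem1:
  fixes a b c d m1 m2 :: real
    and M N :: "real pmodule"
    and P :: "(real \<times> real) set list"
  assumes "0 \<le> a" "a < b" "0 \<le> c" "c < d"
  defines "M \<equiv> interval_module a b"
    and "N \<equiv> interval_module c d"
    and "m1 \<equiv> max \<bar>a - c\<bar> \<bar>b - d\<bar>"
    and "m2 \<equiv> max ((b - a) / 2) ((d - c) / 2)"
  defines "P \<equiv> progression (interleaving_variety M N)"
  shows
    "(\<exists>!vs. is_progression (interleaving_variety M N) vs) \<and>
     ((\<exists>A. is_axis A \<and> P = [origin, A, origin]) \<or>
      (\<exists>A. is_axis A \<and> P = [A, origin]) \<or>
      (\<exists>A. is_axis A \<and> P = [hyperbola, plane, A, origin]) \<or>
      P = [hyperbola, plane, origin]) \<and>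
     ((m1 > m2 \<longleftrightarrow> hd P = origin) \<and>
      (hd P = origin \<longleftrightarrow> (\<exists>A. is_axis A \<and> P = [origin, A, origin]))) \<and>
     ((m1 = m2 \<longleftrightarrow> is_axis (hd P)) \<and>
      (is_axis (hd P) \<longleftrightarrow> (\<exists>A. is_axis A \<and> P = [A, origin]))) \<and>
     ((m1 < m2 \<longleftrightarrow> hd P = hyperbola) \<and>
      (hd P = hyperbola \<longleftrightarrow>
         (\<exists>A. is_axis A \<and> P = [hyperbola, plane, A, origin]) \<or> P = [hyperbola, plane, origin]))"
proof -
  let ?V = "interleaving_variety M N"
  note ax = is_axis_distinct
  have not_axis: "\<not> is_axis origin" "\<not> is_axis hyperbola"
    using ax by blast+
  have ex1: "\<exists>!vs. is_progression ?V vs" if "is_progression ?V vs" for vs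
    using that is_progression_unique by blast
  \<comment> \<open>The possible first entries origin, axis and hyperbola are pairwise different, so
    computing \<open>P\<close> in each of these cases yields all equivalences at once.\<close>
  consider "m2 < m1" | "m1 = m2" | "m1 < m2"
    by linarith
  then show ?thesis
  proof cases
    case 1
    then obtain A where A: "is_axis A" "is_progression ?V [origin, A, origin]"
      using progression_greater[OF assms(1-4)] unfolding assms(5-8) by blast
    have P: "P = [origin, A, origin]"
      unfolding P_def by (rule progression_eq[OF A(2)])
    show ?thesis
      using 1 A(1) ex1[OF A(2)] not_axis variety_distinct unfolding P by auto
  next
    case 2
    then obtain A where A: "is_axis A" "is_progression ?V [A, origin]"
      using progression_equal[OF assms(1-4)] unfolding assms(5-8) by blast
    have P: "P = [A, origin]"
      unfolding P_def by (rule progression_eq[OF A(2)])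
    show ?thesis
      using 2 A(1) ex1[OF A(2)] ax[OF A(1)] unfolding P by auto
  next
    case 3
    then consider A where "is_axis A" "is_progression ?V [hyperbola, plane, A, origin]"
      | "is_progression ?V [hyperbola, plane, origin]"
      using progression_less[OF assms(1-4)] unfolding assms(5-8) by blast
    then show ?thesis
    proof cases
      case (1 A)
      have P: "P = [hyperbola, plane, A, origin]"
        unfolding P_def by (rule progression_eq[OF 1(2)])
      show ?thesis
        using 3 1(1) ex1[OF 1(2)] not_axis variety_distinct unfolding P by auto
    next
      case 2
      have P: "P = [hyperbola, plane, origin]"
        unfolding P_def by (rule progression_eq[OF 2])
      show ?thesis
        using 3 ex1[OF 2] not_axis variety_distinct unfolding P by auto
    qed
  qed
qed

end
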